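(* Let $M$ be an $n$-dimensional complex manifold. For any Hermitian holomorphic vector bundle $V$ on $M$, any $\eta\in A^{n,*}(V)$ and any $\phi_1,\phi_2\in A^{0,1}(M,T^{1,0}_M)$, $$[\phi_1,\phi_2]\lrcorner\eta=\phi_1\lrcorner\nabla(\phi_2\lrcorner\eta)-\nabla\big(\phi_2\lrcorner(\phi_1\lrcorner\eta)\big)+\phi_2\lrcorner\nabla(\phi_1\lrcorner\eta)-\phi_2\lrcorner(\phi_1\lrcorner\nabla\eta),$$ where $\nabla$ is the Chern connection of the Hermitian holomorphic vector bundle $V$.
   Context: $A^{p,q}(V)=A^{p,q}(M,V)$ is the space of smooth $(p,q)$-forms on $M$ with coefficients in $V$; $A^{n,*}$ means bidegree $(n,q)$ with $q$ arbitrary. The Chern connection is extended to $V$-valued forms by $\nabla(\tau\otimes s)=d\tau\otimes s+(-1)^k\tau\wedge\nabla s$ for a $k$-form $\tau$ and a smooth section $s$ of $V$. In local holomorphic coordinates $z^1,\dots,z^n$ write $\partial_i=\partial/\partial z^i$. Bracket: for $\varphi=\sum_i\varphi^i\otimes\partial_i$ and $\psi=\sum_i\psi^i\otimes\partial_i$ in $A^{0,1}(M,T^{1,0}_M)$ (so $\varphi^i,\psi^i$ are local $(0,1)$-forms), $$[\varphi,\psi]=\sum_{i,j=1}^n\big(\varphi^i\wedge\partial_i\psi^j+\psi^i\wedge\partial_i\varphi^j\big)\otimes\partial_j\in A^{0,2}(M,T^{1,0}_M),$$ where $\partial_i\varphi^j$ is obtained by applying $\partial_i$ to the coefficients of $\varphi^j$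 with respect to $d\bar z^1,\dots,d\bar z^n$. Contraction: for $\varphi=\sum_i\varphi^i\otimes\partial_i\in A^{0,q}(M,T^{1,0}_M)$ and a form $\omega$, $\varphi\lrcorner\omega=\sum_i\varphi^i\wedge(\partial_i\lrcorner\omega)$, and $\varphi\lrcorner(\omega\otimes s)=(\varphi\lrcorner\omega)\otimes s$. *)

theory Defs
  imports "HOL-Analysis.Analysis" "HOL-Library.Function_Algebras"
begin

section \<open>Functions on complex n-space\<close>

text \<open>
  An index \<open>Inl i\<close> stands for the coordinate \<open>z\<^sup>i\<close> and \<open>Inr i\<close> for its conjugate; so the
  complexified tangent space has the frame \<open>\<partial>\<^sub>i\<close> (\<open>Inl i\<close>), \<open>\<partial>\<close>-bar\<open>\<^sub>i\<close> (\<open>Inr i\<close>), and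
  \<open>wirtinger\<close> is the usual pair of operators \<open>(\<partial>/\<partial>x\<^sup>i \<mp> \<i> \<partial>/\<partial>y\<^sup>i) / 2\<close>.
\<close>

type_synonym 'n idx = "'n + 'n"

fun conj_idx :: "'n idx \<Rightarrow> 'n idx" where
  "conj_idx (Inl i) = Inr i"
| "conj_idx (Inr i) = Inl i"

fun wirtinger :: "'n::finite idx \<Rightarrow> (complex^'n \<Rightarrow> complex) \<Rightarrow> complex^'n \<Rightarrow> complex" where
  "wirtinger (Inl i) f z =
     (frechet_derivative f (at z) (axis i 1) - \<i> * frechet_derivative f (at z) (axis i \<i>)) / 2"
| "wirtinger (Inr i) f z =
     (frechet_derivative f (at z) (axis i 1) + \<i> * frechet_derivative f (at z) (axis i \<i>)) / 2"

primrec Ck_on :: "nat \<Rightarrow> (complex^'n::finite) set \<Rightarrow> (complex^'n \<Rightarrow> complex) \<Rightarrow> bool" where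
  "Ck_on 0 S f \<longleftrightarrow> continuous_on S f"
| "Ck_on (Suc k) S f \<longleftrightarrow> (\<forall>z\<in>S. f differentiable (at z)) \<and>
     (\<forall>v. Ck_on k S (\<lambda>z. frechet_derivative f (at z) v))"

definition smooth_on :: "(complex^'n::finite) set \<Rightarrow> (complex^'n \<Rightarrow> complex) \<Rightarrow> bool" where
  "smooth_on S f \<longleftrightarrow> (\<forall>k. Ck_on k S f)"

text \<open>
  \<open>S\<close> is meant to be open, and differentiability is over the reals; holomorphic means smooth and
  annihilated by the Cauchy--Riemann operators.
\<close>

definition holo_on :: "(complex^'n::finite) set \<Rightarrow> (complex^'n \<Rightarrow> complex) \<Rightarrow> bool" where
  "holo_on S f \<longleftrightarrow> smooth_on S f \<and> (\<forall>z\<in>S. \<forall>i. wirtinger (Inr i) f z = 0)"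


section \<open>Complex manifolds\<close>

type_synonym ('m, 'n) chart = "'m set \<times> ('m \<Rightarrow> complex^'n)"

definition chart_inv :: "('m, 'n::finite) chart \<Rightarrow> complex^'n \<Rightarrow> 'm" where
  "chart_inv c = inv_into (fst c) (snd c)"

text \<open>The manifold is the whole type \<open>'m\<close> (Hausdorff and second countable), of dimension \<open>CARD('n)\<close>.\<close>

definition complex_manifold ::
    "('m::{t2_space, second_countable_topology}, 'n::finite) chart set \<Rightarrow> bool" where
  "complex_manifold A \<longleftrightarrow>
     (\<Union>c\<in>A. fst c) = UNIV \<and>
     (\<forall>c\<in>A. open (fst c) \<and> open (snd c ` fst c) \<and>
        homeomorphism (fst c) (snd c ` fst c) (snd c) (chart_inv c)) \<and>
     (\<forall>c\<in>A. \<forall>c'\<in>A. \<forall>i. holo_on (snd c ` (fst c \<inter> fst c')) (\<lambda>z. snd c' (chart_inv c z) $ i))"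

definition smooth_in :: "('m, 'n::finite) chart \<Rightarrow> 'm set \<Rightarrow> ('m \<Rightarrow> complex) \<Rightarrow> bool" where
  "smooth_in c S f \<longleftrightarrow> smooth_on (snd c ` (S \<inter> fst c)) (f \<circ> chart_inv c)"

definition holo_in :: "('m, 'n::finite) chart \<Rightarrow> 'm set \<Rightarrow> ('m \<Rightarrow> complex) \<Rightarrow> bool" where
  "holo_in c S f \<longleftrightarrow> holo_on (snd c ` (S \<inter> fst c)) (f \<circ> chart_inv c)"

definition pd :: "('m, 'n::finite) chart \<Rightarrow> 'n idx \<Rightarrow> ('m \<Rightarrow> complex) \<Rightarrow> 'm \<Rightarrow> complex" where
  "pd c a f p = wirtinger a (f \<circ> chart_inv c) (snd c p)"

fun coord :: "('m, 'n::finite) chart \<Rightarrow> 'n idx \<Rightarrow> 'm \<Rightarrow> complex" where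
  "coord c (Inl i) p = snd c p $ i"
| "coord c (Inr i) p = cnj (snd c p $ i)"

definition jac :: "('m, 'n::finite) chart \<Rightarrow> ('m, 'n) chart \<Rightarrow> 'm \<Rightarrow> 'n idx \<Rightarrow> 'n idx \<Rightarrow> complex" where
  "jac c c' p b a = pd c a (coord c' b) p"


section \<open>Exterior algebra at a point\<close>

text \<open>
  A complex exterior form at a point, relative to a chart, is given by its values
  \<open>\<omega> [a\<^sub>1, \<dots>, a\<^sub>k] = \<omega>(\<partial>\<^bsub>a1\<^esub>, \<dots>, \<partial>\<^bsub>ak\<^esub>)\<close> on the coordinate frame. For increasing multi-indices
  these are the coefficients of \<open>dz\<^sup>I \<and> d\<close>z-bar\<open>\<^sup>J\<close>, where
  \<open>(dz\<^sup>1 \<and> dz\<^sup>2)(\<partial>\<^sub>1, \<partial>\<^sub>2) = 1\<close>. A \<open>k\<close>-form vanishes on lists of length other than \<open>k\<close>.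
\<close>

type_synonym 'n eform = "'n idx list \<Rightarrow> complex"

definition is_kform :: "nat \<Rightarrow> 'n eform \<Rightarrow> bool" where
  "is_kform k \<omega> \<longleftrightarrow> (\<forall>a. length a \<noteq> k \<longrightarrow> \<omega> a = 0) \<and>
     (\<forall>a i j. i < j \<and> j < length a \<longrightarrow> \<omega> (a[i := a ! j, j := a ! i]) = - \<omega> a)"

definition is_pqform :: "nat \<Rightarrow> nat \<Rightarrow> 'n eform \<Rightarrow> bool" where
  "is_pqform p q \<omega> \<longleftrightarrow> is_kform (p + q) \<omega> \<and>
     (\<forall>a. length (filter isl a) \<noteq> p \<or> length (filter (\<lambda>x. \<not> isl x) a) \<noteq> q \<longrightarrow> \<omega> a = 0)"

text \<open>The wedge product as a sum over shuffles: \<open>S\<close> is the set of positions fed to the left factor.\<close>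

definition wedge :: "'n eform \<Rightarrow> 'n eform \<Rightarrow> 'n eform" where
  "wedge \<alpha> \<beta> a = (\<Sum>S\<in>Pow {..<length a}.
     (- 1) ^ card {(i, j). i \<in> S \<and> j \<in> {..<length a} - S \<and> j < i} *
     \<alpha> (nths a S) * \<beta> (nths a ({..<length a} - S)))"

definition interior_partial :: "'n \<Rightarrow> 'n eform \<Rightarrow> 'n eform" where
  "interior_partial i \<omega> a = \<omega> (Inl i # a)"

definition pull :: "('n::finite idx \<Rightarrow> 'n idx \<Rightarrow> complex) \<Rightarrow> 'n eform \<Rightarrow> 'n eform" where
  "pull J \<omega> a = (\<Sum>b | length b = length a. (\<Prod>l<length a. J (b ! l) (a ! l)) * \<omega> b)"

definition ext_d :: "('m, 'n::finite) chart \<Rightarrow> ('m \<Rightarrow> 'n eform) \<Rightarrow> 'm \<Rightarrow> 'n eform" where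
  "ext_d c \<omega> p a = (\<Sum>j<length a. (- 1) ^ j * pd c (a ! j) (\<lambda>x. \<omega> x (nths a (- {j}))) p)"


section \<open>Holomorphic vector bundles and Hermitian metrics\<close>

type_synonym ('m, 'e, 'r) triv = "'m set \<times> ('e \<Rightarrow> complex^'r)"

text \<open>
  A trivialization over \<open>W\<close> is recorded by the fibre component \<open>\<Phi>\<close> of the homeomorphism
  \<open>e \<mapsto> (\<pi> e, \<Phi> e)\<close> from \<open>\<pi>\<^sup>-\<^sup>1 W\<close> to \<open>W \<times> \<complex>\<^sup>r\<close>; \<open>fib_vec \<pi> t p u\<close> is the
  fibre element with components \<open>u\<close>, and \<open>frame \<pi> t j\<close> is the \<open>j\<close>-th local frame section.
\<close>

definition fib_vec :: "('e \<Rightarrow> 'm) \<Rightarrow> ('m, 'e, 'r::finite) triv \<Rightarrow> 'm \<Rightarrow> complex^'r \<Rightarrow> 'e" where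
  "fib_vec \<pi> t p u = (THE e. \<pi> e = p \<and> snd t e = u)"

definition frame :: "('e \<Rightarrow> 'm) \<Rightarrow> ('m, 'e, 'r::finite) triv \<Rightarrow> 'r \<Rightarrow> 'm \<Rightarrow> 'e" where
  "frame \<pi> t j p = fib_vec \<pi> t p (axis j 1)"

definition trans_mat ::
    "('e \<Rightarrow> 'm) \<Rightarrow> ('m, 'e, 'r::finite) triv \<Rightarrow> ('m, 'e, 'r) triv \<Rightarrow> 'm \<Rightarrow> complex^'r^'r" where
  "trans_mat \<pi> t t' p = (\<chi> i j. snd t (frame \<pi> t' j p) $ i)"

definition holomorphic_vector_bundle ::
    "('m::{t2_space, second_countable_topology}, 'n::finite) chart set \<Rightarrow>
     ('e::topological_space \<Rightarrow> 'm) \<Rightarrow> ('m, 'e, 'r::finite) triv set \<Rightarrow> bool" where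
  "holomorphic_vector_bundle A \<pi> T \<longleftrightarrow>
     (\<Union>t\<in>T. fst t) = UNIV \<and>
     (\<forall>t\<in>T. open (fst t) \<and>
        (\<exists>g. homeomorphism (\<pi> -` fst t) (fst t \<times> UNIV) (\<lambda>e. (\<pi> e, snd t e)) g)) \<and>
     (\<forall>t\<in>T. \<forall>t'\<in>T.
        (\<forall>e. \<pi> e \<in> fst t \<inter> fst t' \<longrightarrow> snd t e = trans_mat \<pi> t t' (\<pi> e) *v snd t' e) \<and>
        (\<forall>c\<in>A. \<forall>i j. holo_in c (fst t \<inter> fst t') (\<lambda>p. trans_mat \<pi> t t' p $ i $ j)))"

text \<open>
  The vector space structure of the fibres, which makes all trivializations linear. Addition is
  meant for two elements of the same fibre.
\<close>

definition fib_add ::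
    "('e \<Rightarrow> 'm) \<Rightarrow> ('m, 'e, 'r::finite) triv set \<Rightarrow> 'e \<Rightarrow> 'e \<Rightarrow> 'e" where
  "fib_add \<pi> T e e' =
     (THE f. \<pi> f = \<pi> e \<and> (\<forall>t\<in>T. \<pi> e \<in> fst t \<longrightarrow> snd t f = snd t e + snd t e'))"

definition fib_scale ::
    "('e \<Rightarrow> 'm) \<Rightarrow> ('m, 'e, 'r::finite) triv set \<Rightarrow> complex \<Rightarrow> 'e \<Rightarrow> 'e" where
  "fib_scale \<pi> T k e =
     (THE f. \<pi> f = \<pi> e \<and> (\<forall>t\<in>T. \<pi> e \<in> fst t \<longrightarrow> snd t f = k *s snd t e))"

text \<open>Smooth sections over an open set \<open>S\<close>; values outside \<open>S\<close> are irrelevant.\<close>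

definition smooth_section ::
    "('m, 'n::finite) chart set \<Rightarrow> ('e \<Rightarrow> 'm) \<Rightarrow> ('m, 'e, 'r::finite) triv set \<Rightarrow> 'm set \<Rightarrow>
     ('m \<Rightarrow> 'e) \<Rightarrow> bool" where
  "smooth_section A \<pi> T S s \<longleftrightarrow> (\<forall>p\<in>S. \<pi> (s p) = p) \<and>
     (\<forall>c\<in>A. \<forall>t\<in>T. \<forall>i. smooth_in c (S \<inter> fst t) (\<lambda>p. snd t (s p) $ i))"

text \<open>Hermitian metrics are linear in the first and conjugate-linear in the second argument.\<close>

definition hermitian_metric ::
    "('m, 'n::finite) chart set \<Rightarrow> ('e \<Rightarrow> 'm) \<Rightarrow> ('m, 'e, 'r::finite) triv set \<Rightarrow>
     ('e \<Rightarrow> 'e \<Rightarrow> complex) \<Rightarrow> bool" where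
  "hermitian_metric A \<pi> T h \<longleftrightarrow>
     (\<forall>e e' f. \<pi> e = \<pi> f \<and> \<pi> e' = \<pi> f \<longrightarrow> h (fib_add \<pi> T e e') f = h e f + h e' f) \<and>
     (\<forall>k e f. \<pi> e = \<pi> f \<longrightarrow> h (fib_scale \<pi> T k e) f = k * h e f) \<and>
     (\<forall>e f. \<pi> e = \<pi> f \<longrightarrow> h e f = cnj (h f e)) \<and>
     (\<forall>t\<in>T. \<forall>e. \<pi> e \<in> fst t \<and> snd t e \<noteq> 0 \<longrightarrow> 0 < Re (h e e)) \<and>
     (\<forall>c\<in>A. \<forall>t\<in>T. \<forall>i j. smooth_in c (fst t) (\<lambda>p. h (frame \<pi> t i p) (frame \<pi> t j p)))"


section \<open>Bundle-valued forms\<close>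

text \<open>
  A \<open>V\<close>-valued form is given, for every chart \<open>c\<close> and trivialization \<open>t\<close>, by its components
  \<open>\<eta> c t p b\<close> with respect to the frame of \<open>t\<close>, that is \<open>\<eta> = \<Sum>\<^sub>b \<eta> c t _ b \<otimes> e\<^sub>b\<close>, subject to the
  transformation law. Components matter only over the domains of \<open>c\<close> and \<open>t\<close>, so equality of forms
  over \<open>S\<close> is \<open>vform_eq\<close>. Sums and differences of forms are pointwise.
\<close>

type_synonym ('m, 'n, 'e, 'r) vform =
  "('m, 'n) chart \<Rightarrow> ('m, 'e, 'r) triv \<Rightarrow> 'm \<Rightarrow> 'r \<Rightarrow> 'n eform"

definition vform_eq ::
    "('m, 'n::finite) chart set \<Rightarrow> ('m, 'e, 'r::finite) triv set \<Rightarrow> 'm set \<Rightarrow>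
     ('m, 'n, 'e, 'r) vform \<Rightarrow> ('m, 'n, 'e, 'r) vform \<Rightarrow> bool" where
  "vform_eq A T S \<eta> \<eta>' \<longleftrightarrow>
     (\<forall>c\<in>A. \<forall>t\<in>T. \<forall>p \<in> S \<inter> fst c \<inter> fst t. \<eta> c t p = \<eta>' c t p)"

definition smooth_kform ::
    "('m, 'n::finite) chart set \<Rightarrow> ('e \<Rightarrow> 'm) \<Rightarrow> ('m, 'e, 'r::finite) triv set \<Rightarrow> 'm set \<Rightarrow>
     nat \<Rightarrow> ('m, 'n, 'e, 'r) vform \<Rightarrow> bool" where
  "smooth_kform A \<pi> T S k \<eta> \<longleftrightarrow>
     (\<forall>c\<in>A. \<forall>t\<in>T. \<forall>b.
        (\<forall>p \<in> S \<inter> fst c \<inter> fst t. is_kform k (\<eta> c t p b)) \<and>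
        (\<forall>a. smooth_in c (S \<inter> fst t) (\<lambda>p. \<eta> c t p b a))) \<and>
     (\<forall>c\<in>A. \<forall>c'\<in>A. \<forall>t\<in>T. \<forall>t'\<in>T. \<forall>p \<in> S \<inter> fst c \<inter> fst c' \<inter> fst t \<inter> fst t'. \<forall>b a.
        \<eta> c t p b a =
          (\<Sum>b'\<in>UNIV. trans_mat \<pi> t t' p $ b $ b' * pull (jac c c' p) (\<eta> c' t' p b') a))"

definition smooth_pqform ::
    "('m, 'n::finite) chart set \<Rightarrow> ('e \<Rightarrow> 'm) \<Rightarrow> ('m, 'e, 'r::finite) triv set \<Rightarrow>
     nat \<Rightarrow> nat \<Rightarrow> ('m, 'n, 'e, 'r) vform \<Rightarrow> bool" where
  "smooth_pqform A \<pi> T p q \<eta> \<longleftrightarrow> smooth_kform A \<pi> T UNIV (p + q) \<eta> \<and>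
     (\<forall>c\<in>A. \<forall>t\<in>T. \<forall>x \<in> fst c \<inter> fst t. \<forall>b. is_pqform p q (\<eta> c t x b))"

text \<open>
  An element \<open>\<phi> = \<Sum>\<^sub>i \<phi>\<^sup>i \<otimes> \<partial>\<^sub>i\<close> of \<open>A\<^bsup>0,q\<^esup>(M, T\<^bsup>1,0\<^esup>)\<close> is given by \<open>\<phi> c p i = \<phi>\<^sup>i\<close> at \<open>p\<close>.
\<close>

type_synonym ('m, 'n) tform = "('m, 'n) chart \<Rightarrow> 'm \<Rightarrow> 'n \<Rightarrow> 'n eform"

definition smooth_0q_T10 :: "('m, 'n::finite) chart set \<Rightarrow> nat \<Rightarrow> ('m, 'n) tform \<Rightarrow> bool" where
  "smooth_0q_T10 A q \<phi> \<longleftrightarrow>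
     (\<forall>c\<in>A. \<forall>i. (\<forall>p \<in> fst c. is_pqform 0 q (\<phi> c p i)) \<and>
        (\<forall>a. smooth_in c UNIV (\<lambda>p. \<phi> c p i a))) \<and>
     (\<forall>c\<in>A. \<forall>c'\<in>A. \<forall>p \<in> fst c \<inter> fst c'. \<forall>j a.
        (\<Sum>i\<in>UNIV. jac c c' p (Inl j) (Inl i) * \<phi> c p i a) = pull (jac c c' p) (\<phi> c' p j) a)"

definition bracket :: "('m, 'n::finite) tform \<Rightarrow> ('m, 'n) tform \<Rightarrow> ('m, 'n) tform" where
  "bracket \<phi> \<psi> c p j =
     (\<Sum>i\<in>UNIV. wedge (\<phi> c p i) (\<lambda>a. pd c (Inl i) (\<lambda>x. \<psi> c x j a) p)
             + wedge (\<psi> c p i) (\<lambda>a. pd c (Inl i) (\<lambda>x. \<phi> c x j a) p))"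

definition contract ::
    "('m, 'n::finite) tform \<Rightarrow> ('m, 'n, 'e, 'r) vform \<Rightarrow> ('m, 'n, 'e, 'r) vform"
    (infixr "\<lrcorner>" 75) where
  "(\<phi> \<lrcorner> \<eta>) c t p b = (\<Sum>i\<in>UNIV. wedge (\<phi> c p i) (interior_partial i (\<eta> c t p b)))"


section \<open>The Chern connection\<close>

text \<open>
  A connection assigns to an open set \<open>S\<close> and a smooth section \<open>s\<close> over \<open>S\<close> a \<open>V\<close>-valued 1-form
  \<open>D S s\<close> over \<open>S\<close>, compatibly with restriction. In the Leibniz rule, \<open>snd t (s p) $ b\<close> is the
  \<open>b\<close>-th component of \<open>s\<close>, so the first summand is \<open>df \<otimes> s\<close>.
\<close>

definition connection ::
    "('m::topological_space, 'n::finite) chart set \<Rightarrow> ('e \<Rightarrow> 'm) \<Rightarrow>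
     ('m, 'e, 'r::finite) triv set \<Rightarrow>
     ('m set \<Rightarrow> ('m \<Rightarrow> 'e) \<Rightarrow> ('m, 'n, 'e, 'r) vform) \<Rightarrow> bool" where
  "connection A \<pi> T D \<longleftrightarrow>
     (\<forall>S s. open S \<and> smooth_section A \<pi> T S s \<longrightarrow> smooth_kform A \<pi> T S 1 (D S s)) \<and>
     (\<forall>S S' s s'. open S \<and> open S' \<and> S' \<subseteq> S \<and> smooth_section A \<pi> T S s \<and> (\<forall>p\<in>S'. s' p = s p)
        \<longrightarrow> vform_eq A T S' (D S' s') (D S s)) \<and>
     (\<forall>S s s'. open S \<and> smooth_section A \<pi> T S s \<and> smooth_section A \<pi> T S s'
        \<longrightarrow> vform_eq A T S (D S (\<lambda>p. fib_add \<pi> T (s p) (s' p))) (D S s + D S s')) \<and>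
     (\<forall>S s f. open S \<and> smooth_section A \<pi> T S s \<and> (\<forall>c\<in>A. smooth_in c S f)
        \<longrightarrow> vform_eq A T S (D S (\<lambda>p. fib_scale \<pi> T (f p) (s p)))
              (\<lambda>c t p b a. ext_d c (\<lambda>x a. if a = [] then f x else 0) p a * snd t (s p) $ b
                            + f p * D S s c t p b a))"

text \<open>
  Metric compatibility is \<open>d(h(s, u)) = h(\<nabla>s, u) + h(s, \<nabla>u)\<close>, evaluated on the coordinate vector
  \<open>\<partial>\<^sub>a\<close>; since \<open>h(s, \<alpha> \<otimes> v)\<close> is the conjugate of \<open>\<alpha>\<close> times \<open>h(s, v)\<close>, the last
  term involves \<open>\<nabla>u\<close> on the conjugate vector.
\<close>

definition metric_connection ::
    "('m::topological_space, 'n::finite) chart set \<Rightarrow> ('e \<Rightarrow> 'm) \<Rightarrow>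
     ('m, 'e, 'r::finite) triv set \<Rightarrow> ('e \<Rightarrow> 'e \<Rightarrow> complex) \<Rightarrow>
     ('m set \<Rightarrow> ('m \<Rightarrow> 'e) \<Rightarrow> ('m, 'n, 'e, 'r) vform) \<Rightarrow> bool" where
  "metric_connection A \<pi> T h D \<longleftrightarrow>
     (\<forall>S s u. open S \<and> smooth_section A \<pi> T S s \<and> smooth_section A \<pi> T S u \<longrightarrow>
        (\<forall>c\<in>A. \<forall>t\<in>T. \<forall>p \<in> S \<inter> fst c \<inter> fst t. \<forall>a.
           pd c a (\<lambda>x. h (s x) (u x)) p =
             h (fib_vec \<pi> t p (\<chi> b. D S s c t p b [a])) (u p)
           + h (s p) (fib_vec \<pi> t p (\<chi> b. D S u c t p b [conj_idx a]))))"

text \<open>The (0,1)-part of \<open>\<nabla>\<close> is the \<open>\<partial>\<close>-bar operator of \<open>V\<close>, taken componentwise in holomorphic frames.\<close>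

definition dbar_connection ::
    "('m::topological_space, 'n::finite) chart set \<Rightarrow> ('e \<Rightarrow> 'm) \<Rightarrow>
     ('m, 'e, 'r::finite) triv set \<Rightarrow>
     ('m set \<Rightarrow> ('m \<Rightarrow> 'e) \<Rightarrow> ('m, 'n, 'e, 'r) vform) \<Rightarrow> bool" where
  "dbar_connection A \<pi> T D \<longleftrightarrow>
     (\<forall>S s. open S \<and> smooth_section A \<pi> T S s \<longrightarrow>
        (\<forall>c\<in>A. \<forall>t\<in>T. \<forall>p \<in> S \<inter> fst c \<inter> fst t. \<forall>b i.
           D S s c t p b [Inr i] = pd c (Inr i) (\<lambda>x. snd t (s x) $ b) p))"

definition chern_connection ::
    "('m::topological_space, 'n::finite) chart set \<Rightarrow> ('e \<Rightarrow> 'm) \<Rightarrow>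
     ('m, 'e, 'r::finite) triv set \<Rightarrow> ('e \<Rightarrow> 'e \<Rightarrow> complex) \<Rightarrow>
     ('m set \<Rightarrow> ('m \<Rightarrow> 'e) \<Rightarrow> ('m, 'n, 'e, 'r) vform) \<Rightarrow> bool" where
  "chern_connection A \<pi> T h D \<longleftrightarrow>
     connection A \<pi> T D \<and> metric_connection A \<pi> T h D \<and> dbar_connection A \<pi> T D"

text \<open>
  The extension of a connection to \<open>V\<close>-valued \<open>k\<close>-forms: the rule
  \<open>\<nabla>(\<tau> \<otimes> s) = d\<tau> \<otimes> s + (-1)\<^sup>k \<tau> \<and> \<nabla>s\<close> applied to \<open>\<eta> = \<Sum>\<^sub>b \<eta>\<^sup>b \<otimes> e\<^sub>b\<close> over the domain of \<open>t\<close>.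
\<close>

definition nabla ::
    "('e \<Rightarrow> 'm) \<Rightarrow> ('m set \<Rightarrow> ('m \<Rightarrow> 'e) \<Rightarrow> ('m, 'n::finite, 'e, 'r::finite) vform) \<Rightarrow> nat \<Rightarrow>
     ('m, 'n, 'e, 'r) vform \<Rightarrow> ('m, 'n, 'e, 'r) vform" where
  "nabla \<pi> D k \<eta> c t p b a =
     ext_d c (\<lambda>x. \<eta> c t x b) p a
     + (- 1) ^ k * (\<Sum>b'\<in>UNIV. wedge (\<eta> c t p b') (D (fst t) (frame \<pi> t b') c t p b) a)"

end

theory Submission
  imports Defs
begin

text \<open>
  Write \<open>i\<^sub>1\<close> and \<open>i\<^sub>2\<close> for the contractions with \<open>\<phi>\<^sub>1\<close> and \<open>\<phi>\<^sub>2\<close>. They commute on alternating forms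
  (\<open>contraction_commute\<close>), so the right-hand side of the theorem is the iterated commutator
  \<open>[[i\<^sub>1, \<nabla>], i\<^sub>2] \<eta>\<close>. The claim is local: in a chart and a holomorphic frame, \<open>\<nabla>\<close> is the sum of
  \<open>d\<close>, taken componentwise, and multiplication by a matrix of 1-forms \<open>\<theta>\<close>, and the two parts are
  treated separately.

  A contraction with \<open>\<phi> = \<Sum>\<^sub>i \<phi>\<^sup>i \<otimes> \<partial>\<^sub>i\<close>, where the \<open>\<phi>\<^sup>i\<close> are 1-forms, is a derivation of degree \<open>0\<close>
  of the exterior algebra (\<open>contraction_wedge\<close>), and it kills forms of type \<open>(0,1)\<close>. Therefore the
  part of \<open>\<theta>\<close> contributes only wedge products with \<open>i\<^sub>2 i\<^sub>1 \<theta>\<close>, which vanish because \<open>i\<^sub>1 \<theta>\<close> has type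
  \<open>(0,1)\<close> (\<open>tian_todorov_wedge_one_form\<close>). For the other part, write \<open>d = \<Sum>\<^sub>x e\<^sup>x \<and> \<partial>\<^sub>x\<close> with the
  coordinate coframe \<open>e\<^sup>x\<close> and the coefficientwise derivatives \<open>\<partial>\<^sub>x\<close>, the index \<open>x\<close> running over both
  types of coordinates. The derivation property and the Leibniz rule give
  \<open>[i\<^sub>1, d] = \<Sum>\<^sub>i \<phi>\<^sub>1\<^sup>i \<and> \<partial>\<^sub>i - \<Sum>\<^sub>x e\<^sup>x \<and> (\<partial>\<^sub>x \<phi>\<^sub>1) \<lrcorner>\<close>, and the commutator of this operator with
  \<open>i\<^sub>2\<close> is \<open>\<Sum>\<^sub>i \<phi>\<^sub>1\<^sup>i \<and> (\<partial>\<^sub>i \<phi>\<^sub>2) \<lrcorner> + \<Sum>\<^sub>i \<phi>\<^sub>2\<^sup>i \<and> (\<partial>\<^sub>i \<phi>\<^sub>1) \<lrcorner>\<close>, which is the contraction with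
  \<open>[\<phi>\<^sub>1, \<phi>\<^sub>2]\<close> (\<open>tian_todorov_ext_d\<close>).

  The algebra underneath is that of the shuffle product. Splitting off the first argument turns the
  sum over shuffles into a recursion (\<open>wedge_Cons\<close>), from which associativity and the sign rules follow
  by induction on the list of arguments.
\<close>

section \<open>The exterior algebra by recursion on the arguments\<close>

text \<open>
  The grade involution, \<open>(-1)\<^sup>k\<close> on \<open>k\<close>-forms. With it the sign rules below hold for forms of mixed
  degree, so that degrees need not be tracked through a computation.
\<close>

definition grade_inv :: "'n eform \<Rightarrow> 'n eform" where
  "grade_inv \<alpha> a = (- 1) ^ length a * \<alpha> a"

text \<open>
  Interior multiplication \<open>\<iota>\<^sub>x\<close> by the coordinate vector \<open>\<partial>\<^sub>x\<close>, of either type.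
\<close>

definition iota :: "'n idx \<Rightarrow> 'n eform \<Rightarrow> 'n eform" where
  "iota x \<omega> a = \<omega> (x # a)"

lemma sum_Pow_lessThan_Suc:
  fixes g :: "nat set \<Rightarrow> 'a::comm_monoid_add"
  shows "(\<Sum>S\<in>Pow {..<Suc m}. g S) =
    (\<Sum>S\<in>Pow {..<m}. g (insert 0 (Suc ` S))) + (\<Sum>S\<in>Pow {..<m}. g (Suc ` S))"
proof -
  have P: "Pow (Suc ` {..<m}) = image Suc ` Pow {..<m}"
    by (simp add: image_Pow_surj)
  have inj: "inj_on (image Suc) (Pow {..<m})"
    by (meson inj_Suc inj_image_eq_iff inj_onI)
  have "Pow {..<Suc m} = (insert 0 ` image Suc ` Pow {..<m}) \<union> image Suc ` Pow {..<m}"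
    unfolding lessThan_Suc_eq_insert_0 Pow_insert P by auto
  moreover have "inj_on (insert 0) (image Suc ` Pow {..<m})"
    by (rule inj_onI) auto
  moreover have "(insert 0 ` image Suc ` Pow {..<m}) \<inter> image Suc ` Pow {..<m} = {}"
    by auto
  ultimately show ?thesis
    using inj by (simp add: sum.union_disjoint sum.reindex o_def)
qed

lemma wedge_Nil [simp]: "wedge \<alpha> \<beta> [] = \<alpha> [] * \<beta> []"
  by (simp add: wedge_def)

text \<open>
  This recursion replaces the sum over shuffles in all that follows. A shuffle either feeds the first
  argument \<open>x\<close> to the left factor, where it stands first and causes no inversion, or to the right
  factor, where it is inverted with each of the arguments of the left factor; the grade involution
  accounts for those inversions.
\<close>

lemma wedge_Cons:
  "wedge \<alpha> \<beta> (x # a) = wedge (iota x \<alpha>) \<beta> a + wedge (grade_inv \<alpha>) (iota x \<beta>) a"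
proof -
  define N where "N = {..<length a}"
  have fin: "finite N" by (simp add: N_def)
  have c0: "{j. Suc j \<in> insert 0 (Suc ` S)} = S" "{j. Suc j \<in> Suc ` S} = S"
     "{j. Suc j \<in> {..<Suc (length a)} - insert 0 (Suc ` S)} = N - S"
     "{j. Suc j \<in> {..<Suc (length a)} - Suc ` S} = N - S" for S
    by (auto simp: N_def)
  \<comment> \<open>The position \<open>0\<close> belongs to the left factor: nothing new is inverted.\<close>
  have c1: "card {(i, j). i \<in> insert 0 (Suc ` S) \<and> j \<in> {..<Suc (length a)} - insert 0 (Suc ` S) \<and> j < i}
      = card {(i, j). i \<in> S \<and> j \<in> N - S \<and> j < i}" (is "card ?L = card ?R") for S
  proof -
    have "?L = map_prod Suc Suc ` ?R"
      by (auto simp: N_def image_iff less_Suc_eq_0_disj)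
    moreover have "inj_on (map_prod Suc Suc) ?R"
      by (auto simp: inj_on_def)
    ultimately show ?thesis by (simp add: card_image)
  qed
  \<comment> \<open>The position \<open>0\<close> belongs to the right factor: one new inversion for each \<open>i \<in> S\<close>.\<close>
  have c2: "card {(i, j). i \<in> Suc ` S \<and> j \<in> {..<Suc (length a)} - Suc ` S \<and> j < i}
      = card S + card {(i, j). i \<in> S \<and> j \<in> N - S \<and> j < i}" (is "card ?L = _ + card ?R")
      if "S \<in> Pow N" for S
  proof -
    have finS: "finite S" using that fin by (auto intro: finite_subset)
    have finR: "finite ?R"
      by (rule finite_subset[of _ "S \<times> N"]) (use fin finS in auto)
    have "?L = (\<lambda>i. (Suc i, 0)) ` S \<union> map_prod Suc Suc ` ?R"
      by (auto simp: N_def image_iff less_Suc_eq_0_disj)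
    moreover have "inj_on (map_prod Suc Suc) ?R" "inj_on (\<lambda>i. (Suc i, 0::nat)) S"
      by (auto simp: inj_on_def)
    moreover have "(\<lambda>i. (Suc i, 0)) ` S \<inter> map_prod Suc Suc ` ?R = {}" by auto
    ultimately show ?thesis using finS finR by (simp add: card_image card_Un_disjoint)
  qed
  have len: "length (nths a S) = card S" if "S \<in> Pow N" for S
  proof -
    have "{i. i < length a \<and> i \<in> S} = S" using that by (auto simp: N_def)
    then show ?thesis by (simp add: length_nths)
  qed
  show ?thesis
    unfolding wedge_def length_Cons sum_Pow_lessThan_Suc nths_Cons c0 c1
    unfolding N_def[symmetric]
  proof (intro arg_cong2[where f = "(+)"] sum.cong refl, goal_cases)
    case (1 S)
    then show ?case by (simp add: iota_def)
  next
    case (2 S)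
    show ?case
      by (simp only: c2[OF 2] power_add) (simp add: iota_def grade_inv_def len[OF 2])
  qed
qed

lemma iota_wedge: "iota x (wedge \<alpha> \<beta>) = wedge (iota x \<alpha>) \<beta> + wedge (grade_inv \<alpha>) (iota x \<beta>)"
  by (rule ext) (simp add: iota_def wedge_Cons)

lemma wedge_add_left: "wedge (\<alpha> + \<alpha>') \<beta> = wedge \<alpha> \<beta> + wedge \<alpha>' \<beta>"
  by (rule ext) (simp add: wedge_def algebra_simps sum.distrib)

lemma wedge_add_right: "wedge \<alpha> (\<beta> + \<beta>') = wedge \<alpha> \<beta> + wedge \<alpha> \<beta>'"
  by (rule ext) (simp add: wedge_def algebra_simps sum.distrib)

lemma wedge_zero_left [simp]: "wedge 0 \<beta> = 0"
  by (rule ext) (simp add: wedge_def)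

lemma wedge_zero_right [simp]: "wedge \<alpha> 0 = 0"
  by (rule ext) (simp add: wedge_def)

lemma wedge_uminus_left [simp]: "wedge (- \<alpha>) \<beta> = - wedge \<alpha> \<beta>"
  by (rule ext) (simp add: wedge_def sum_negf)

lemma wedge_uminus_right [simp]: "wedge \<alpha> (- \<beta>) = - wedge \<alpha> \<beta>"
  by (rule ext) (simp add: wedge_def sum_negf)

lemma wedge_diff_right: "wedge \<alpha> (\<beta> - \<beta>') = wedge \<alpha> \<beta> - wedge \<alpha> \<beta>'"
  by (rule ext) (simp add: wedge_def algebra_simps sum_subtractf)

lemma wedge_scale_right: "wedge \<alpha> (\<lambda>a. k * \<beta> a) = (\<lambda>a. k * wedge \<alpha> \<beta> a)"
  by (rule ext) (simp add: wedge_def algebra_simps sum_distrib_left)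

lemma wedge_sum_left: "wedge (\<Sum>i\<in>I. \<alpha> i) \<beta> = (\<Sum>i\<in>I. wedge (\<alpha> i) \<beta>)"
  \<comment> \<open>The pointwise rules for functions would expand the sums before additivity applies.\<close>
  by (induction I rule: infinite_finite_induct)
     (simp_all add: wedge_add_left del: plus_fun_apply zero_fun_apply)

lemma wedge_sum_right: "wedge \<alpha> (\<Sum>i\<in>I. \<beta> i) = (\<Sum>i\<in>I. wedge \<alpha> (\<beta> i))"
  by (induction I rule: infinite_finite_induct)
     (simp_all add: wedge_add_right del: plus_fun_apply zero_fun_apply)

lemma iota_add: "iota x (\<alpha> + \<beta>) = iota x \<alpha> + iota x \<beta>"
  and iota_diff: "iota x (\<alpha> - \<beta>) = iota x \<alpha> - iota x \<beta>"
  and iota_zero: "iota x 0 = 0"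
  by (simp_all add: iota_def fun_eq_iff)

lemma iota_sum: "iota x (\<Sum>i\<in>I. \<alpha> i) = (\<Sum>i\<in>I. iota x (\<alpha> i))"
  by (induction I rule: infinite_finite_induct)
     (simp_all add: iota_add iota_zero del: plus_fun_apply zero_fun_apply)

lemma grade_inv_grade_inv [simp]: "grade_inv (grade_inv \<alpha>) = \<alpha>"
  by (simp add: grade_inv_def fun_eq_iff flip: power_add mult_2)

lemma iota_grade_inv: "iota x (grade_inv \<alpha>) = - grade_inv (iota x \<alpha>)"
  by (simp add: grade_inv_def iota_def fun_eq_iff)

lemma grade_inv_wedge: "grade_inv (wedge \<alpha> \<beta>) = wedge (grade_inv \<alpha>) (grade_inv \<beta>)"
proof
  fix a show "grade_inv (wedge \<alpha> \<beta>) a = wedge (grade_inv \<alpha>) (grade_inv \<beta>) a"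
  proof (induction a arbitrary: \<alpha> \<beta>)
    case Nil
    then show ?case by (simp add: grade_inv_def)
  next
    case (Cons x a)
    have "grade_inv (wedge \<alpha> \<beta>) (x # a)
        = - (grade_inv (wedge (iota x \<alpha>) \<beta>) a + grade_inv (wedge (grade_inv \<alpha>) (iota x \<beta>)) a)"
      by (simp add: grade_inv_def wedge_Cons algebra_simps)
    also have "\<dots> = wedge (grade_inv \<alpha>) (grade_inv \<beta>) (x # a)"
      unfolding Cons.IH wedge_Cons iota_grade_inv by simp
    finally show ?case .
  qed
qed

text \<open>
  Both sides obey the same recursion, since \<open>\<iota>\<^sub>x\<close> is an antiderivation.
\<close>

lemma wedge_assoc: "wedge (wedge \<alpha> \<beta>) \<gamma> = wedge \<alpha> (wedge \<beta> \<gamma>)"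
proof
  fix a show "wedge (wedge \<alpha> \<beta>) \<gamma> a = wedge \<alpha> (wedge \<beta> \<gamma>) a"
  proof (induction a arbitrary: \<alpha> \<beta> \<gamma>)
    case (Cons x a)
    then show ?case
      by (simp add: wedge_Cons iota_wedge grade_inv_wedge wedge_add_left wedge_add_right)
  qed simp
qed

section \<open>Contraction with a vector-valued form is a derivation\<close>

text \<open>
  The type \<open>(0,1)\<close> as a condition on values alone: in degree \<open>1\<close> being alternating says nothing.
\<close>

definition form01 :: "'n eform \<Rightarrow> bool" where
  "form01 \<alpha> \<longleftrightarrow> (\<forall>a. (\<nexists>j. a = [Inr j]) \<longrightarrow> \<alpha> a = 0)"

definition homogeneous :: "nat \<Rightarrow> 'n eform \<Rightarrow> bool" where
  "homogeneous k \<alpha> \<longleftrightarrow> (\<forall>a. length a \<noteq> k \<longrightarrow> \<alpha> a = 0)"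

lemma form01_degree: "form01 \<alpha> \<Longrightarrow> homogeneous 1 \<alpha>"
  unfolding form01_def homogeneous_def by (metis One_nat_def length_Cons list.size(3))

lemma homogeneous_iota: "homogeneous 1 \<alpha> \<Longrightarrow> homogeneous 0 (iota x \<alpha>)"
  by (auto simp: homogeneous_def iota_def)

lemma iota_degree0: "homogeneous 0 \<alpha> \<Longrightarrow> iota x \<alpha> = 0"
  by (auto simp: homogeneous_def iota_def)

lemma grade_inv_degree0: "homogeneous 0 \<alpha> \<Longrightarrow> grade_inv \<alpha> = \<alpha>"
proof
  fix a assume "homogeneous 0 \<alpha>"
  then show "grade_inv \<alpha> a = \<alpha> a"
    by (cases a) (auto simp: homogeneous_def grade_inv_def)
qed

lemma grade_inv_degree1: "homogeneous 1 \<alpha> \<Longrightarrow> grade_inv \<alpha> = - \<alpha>"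
proof
  fix a assume "homogeneous 1 \<alpha>"
  then show "grade_inv \<alpha> a = (- \<alpha>) a"
    by (cases "length a = 1") (auto simp: homogeneous_def grade_inv_def)
qed

lemma wedge_degree0_left:
  assumes "homogeneous 0 \<alpha>" shows "wedge \<alpha> \<beta> a = \<alpha> [] * \<beta> a"
  by (induction a arbitrary: \<beta>)
     (simp_all add: wedge_Cons iota_degree0[OF assms] grade_inv_degree0[OF assms], simp add: iota_def)

lemma wedge_degree0_right:
  assumes "homogeneous 0 \<beta>" shows "wedge \<alpha> \<beta> a = \<beta> [] * \<alpha> a"
  by (induction a arbitrary: \<alpha>)
     (simp_all add: wedge_Cons iota_degree0[OF assms], simp add: iota_def)

text \<open>
  Moving a 1-form past \<open>\<beta>\<close> multiplies the degree \<open>k\<close> part of \<open>\<beta>\<close> by \<open>(-1)\<^sup>k\<close>.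
\<close>

lemma wedge_degree1_commute:
  assumes "homogeneous 1 \<alpha>" shows "wedge \<alpha> \<beta> = wedge (grade_inv \<beta>) \<alpha>"
proof
  fix a show "wedge \<alpha> \<beta> a = wedge (grade_inv \<beta>) \<alpha> a"
  proof (induction a arbitrary: \<beta>)
    case Nil
    then show ?case by (simp add: grade_inv_def)
  next
    case (Cons x a)
    have 0: "homogeneous 0 (iota x \<alpha>)"
      by (rule homogeneous_iota[OF assms])
    show ?case
      unfolding wedge_Cons grade_inv_degree1[OF assms] iota_grade_inv grade_inv_grade_inv
      by (simp add: wedge_degree0_left[OF 0] wedge_degree0_right[OF 0] Cons.IH)
  qed
qed

definition contraction :: "('n::finite \<Rightarrow> 'n eform) \<Rightarrow> 'n eform \<Rightarrow> 'n eform" where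
  "contraction \<phi> \<omega> = (\<Sum>i\<in>UNIV. wedge (\<phi> i) (iota (Inl i) \<omega>))"

lemma contraction_add: "contraction \<phi> (\<alpha> + \<beta>) = contraction \<phi> \<alpha> + contraction \<phi> \<beta>"
  by (simp add: contraction_def iota_add wedge_add_right sum.distrib)

lemma contraction_diff: "contraction \<phi> (\<alpha> - \<beta>) = contraction \<phi> \<alpha> - contraction \<phi> \<beta>"
  by (simp add: contraction_def iota_diff wedge_diff_right sum_subtractf)

lemma contraction_sum: "contraction \<phi> (\<Sum>i\<in>I. \<alpha> i) = (\<Sum>i\<in>I. contraction \<phi> (\<alpha> i))"
  by (simp add: contraction_def iota_sum wedge_sum_right sum.swap[of _ I])

text \<open>
  The two signs cancel: \<open>\<iota>\<^sub>i\<close> passes \<open>\<alpha>\<close> with the grade involution, and so does the 1-form \<open>\<phi>\<^sup>i\<close>.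
  Hence contraction is a derivation of degree \<open>0\<close>.
\<close>

lemma contraction_wedge:
  assumes "\<And>i. homogeneous 1 (\<phi> i)"
  shows "contraction \<phi> (wedge \<alpha> \<beta>) = wedge (contraction \<phi> \<alpha>) \<beta> + wedge \<alpha> (contraction \<phi> \<beta>)"
proof -
  have "wedge (\<phi> i) (wedge (grade_inv \<alpha>) \<gamma>) = wedge \<alpha> (wedge (\<phi> i) \<gamma>)" for i \<gamma>
    using wedge_degree1_commute[OF assms, of i "grade_inv \<alpha>"]
    by (simp flip: wedge_assoc)
  then show ?thesis
    by (simp add: contraction_def iota_wedge wedge_add_right wedge_sum_left wedge_sum_right
        sum.distrib wedge_assoc)
qed

lemma iota_form01: "form01 \<alpha> \<Longrightarrow> iota (Inl i) \<alpha> = 0"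
  by (auto simp: form01_def iota_def)

lemma contraction_form01: "form01 \<alpha> \<Longrightarrow> contraction \<phi> \<alpha> = 0"
  by (simp add: contraction_def iota_form01)

text \<open>
  The form \<open>\<phi> \<lrcorner> \<theta> = \<Sum>\<^sub>i \<theta>(\<partial>\<^sub>i) \<phi>\<^sup>i\<close> is again of type \<open>(0,1)\<close>, and contraction kills that type.
\<close>

lemma contraction_twice_degree1:
  assumes "\<And>i. form01 (\<phi> i)" and "homogeneous 1 \<theta>"
  shows "contraction \<psi> (contraction \<phi> \<theta>) = 0"
proof -
  have "iota (Inl j) (wedge (\<phi> i) (iota (Inl i) \<theta>)) = 0" for i j
    by (simp add: iota_wedge iota_form01[OF assms(1)] iota_degree0 homogeneous_iota[OF assms(2)])
  then show ?thesis by (simp add: contraction_def iota_sum)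
qed

text \<open>
  Since \<open>\<iota>\<^sub>i \<psi>\<^sup>j = 0\<close>, the two-fold contraction is
  \<open>- \<Sum>\<^sub>i\<^sub>j \<phi>\<^sup>i \<and> \<psi>\<^sup>j \<and> \<iota>\<^sub>i \<iota>\<^sub>j \<omega>\<close>, and exchanging \<open>\<phi>\<close> with \<open>\<psi>\<close> changes the sign of both
  \<open>\<phi>\<^sup>i \<and> \<psi>\<^sup>j\<close> and \<open>\<iota>\<^sub>i \<iota>\<^sub>j \<omega>\<close>.
\<close>

lemma contraction_commute:
  assumes \<phi>: "\<And>i. form01 (\<phi> i)" and \<psi>: "\<And>i. form01 (\<psi> i)"
    and skew: "\<And>i j. iota (Inl i) (iota (Inl j) \<omega>) = - iota (Inl j) (iota (Inl i) \<omega>)"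
  shows "contraction \<phi> (contraction \<psi> \<omega>) = contraction \<psi> (contraction \<phi> \<omega>)"
proof -
  have expand: "contraction \<phi> (contraction \<psi> \<omega>) =
      - (\<Sum>i\<in>UNIV. \<Sum>j\<in>UNIV. wedge (wedge (\<phi> i) (\<psi> j)) (iota (Inl i) (iota (Inl j) \<omega>)))"
    if "\<And>i. form01 (\<psi> i)" for \<phi> \<psi> :: "'a \<Rightarrow> 'a eform"
    using that
    by (simp add: contraction_def iota_sum iota_wedge iota_form01 wedge_sum_right wedge_assoc
        grade_inv_degree1[OF form01_degree] sum_negf)
  have "wedge (\<phi> i) (\<psi> j) = - wedge (\<psi> j) (\<phi> i)" for i j
    using wedge_degree1_commute[OF form01_degree[OF \<phi>], of i "\<psi> j"]
    by (simp add: grade_inv_degree1[OF form01_degree] \<psi>)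
  then have "wedge (wedge (\<phi> i) (\<psi> j)) (iota (Inl i) (iota (Inl j) \<omega>))
      = wedge (wedge (\<psi> j) (\<phi> i)) (iota (Inl j) (iota (Inl i) \<omega>))" for i j
    using skew[of i j] by simp
  then show ?thesis
    unfolding expand[OF \<psi>] expand[OF \<phi>]
    by (subst sum.swap) (intro arg_cong[where f = uminus] sum.cong refl)
qed

section \<open>The coordinate coframe\<close>

text \<open>
  The form \<open>dz\<^sup>i\<close> for the index \<open>Inl i\<close>, and its conjugate for \<open>Inr i\<close>.
\<close>

definition coframe :: "'n idx \<Rightarrow> 'n eform" where
  "coframe x a = (if a = [x] then 1 else 0)"

lemma homogeneous_coframe: "homogeneous 1 (coframe x)"
  by (auto simp: homogeneous_def coframe_def)

lemma contraction_coframe: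
  "contraction \<phi> (coframe (Inl i)) = \<phi> i" "contraction \<phi> (coframe (Inr i)) = 0"
proof -
  have *: "wedge (\<phi> j) (iota (Inl j) (coframe x)) = (if x = Inl j then \<phi> j else 0)" for j x
  proof -
    have 0: "homogeneous 0 (iota (Inl j) (coframe x))"
      by (rule homogeneous_iota[OF homogeneous_coframe])
    show ?thesis
      by (rule ext, subst wedge_degree0_right[OF 0]) (simp add: iota_def coframe_def)
  qed
  show "contraction \<phi> (coframe (Inl i)) = \<phi> i" "contraction \<phi> (coframe (Inr i)) = 0"
    by (simp_all add: contraction_def *)
qed

lemma wedge_coframe:
  "wedge (coframe x) \<beta> l =
     (\<Sum>j<length l. if l ! j = x then (- 1) ^ j * \<beta> (nths l (- {j})) else 0)"
proof (induction l arbitrary: \<beta>)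
  case Nil
  then show ?case by (simp add: coframe_def)
next
  case (Cons y l)
  have 0: "homogeneous 0 (iota y (coframe x))"
    by (rule homogeneous_iota[OF homogeneous_coframe])
  have nths: "nths (z # l) (- {0}) = l" "nths (z # l) (- {Suc i}) = z # nths l (- {i})" for z i
  proof -
    have "{j. Suc j \<in> - {0}} = UNIV" "{j. Suc j \<in> - {Suc i}} = - {i}" by auto
    then show "nths (z # l) (- {0}) = l" "nths (z # l) (- {Suc i}) = z # nths l (- {i})"
      by (simp_all add: nths_Cons nths_all)
  qed
  have "wedge (iota y (coframe x)) \<beta> l = (if y = x then \<beta> l else 0)"
    by (subst wedge_degree0_left[OF 0]) (simp add: iota_def coframe_def)
  then have "wedge (coframe x) \<beta> (y # l) = (if y = x then \<beta> l else 0) - wedge (coframe x) (iota y \<beta>) l"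
    by (simp add: wedge_Cons grade_inv_degree1[OF homogeneous_coframe])
  then show ?case
    unfolding Cons.IH length_Cons sum.lessThan_Suc_shift nths
    unfolding diff_conv_add_uminus sum_negf[symmetric]
    by (rule trans) (auto simp: iota_def intro!: arg_cong2[where f = "(+)"] sum.cong)
qed

section \<open>Coefficientwise derivatives of forms\<close>

lemma wirtinger_has_derivative:
  assumes "(f has_derivative f') (at z)"
  shows "wirtinger x f z = (case x of Inl i \<Rightarrow> f' (axis i 1) - \<i> * f' (axis i \<i>)
                                   | Inr i \<Rightarrow> f' (axis i 1) + \<i> * f' (axis i \<i>)) / 2"
  using frechet_derivative_at[OF assms] by (cases x) simp_all

lemma wirtinger_const: "wirtinger x (\<lambda>z. k) z = 0"
  unfolding wirtinger_has_derivative[OF has_derivative_const] by (cases x) simp_all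

lemma wirtinger_add:
  assumes "f differentiable (at z)" and "g differentiable (at z)"
  shows "wirtinger x (\<lambda>w. f w + g w) z = wirtinger x f z + wirtinger x g z"
proof -
  obtain f' g' where fg: "(f has_derivative f') (at z)" "(g has_derivative g') (at z)"
    using assms by (auto simp: differentiable_def)
  show ?thesis
    unfolding wirtinger_has_derivative[OF fg(1)] wirtinger_has_derivative[OF fg(2)]
      wirtinger_has_derivative[OF has_derivative_add[OF fg]]
    by (cases x) (simp_all add: field_simps)
qed

lemma wirtinger_mult:
  assumes "f differentiable (at z)" and "g differentiable (at z)"
  shows "wirtinger x (\<lambda>w. f w * g w) z = wirtinger x f z * g z + f z * wirtinger x g z"
proof -
  obtain f' g' where fg: "(f has_derivative f') (at z)" "(g has_derivative g') (at z)"
    using assms by (auto simp: differentiable_def)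
  show ?thesis
    unfolding wirtinger_has_derivative[OF fg(1)] wirtinger_has_derivative[OF fg(2)]
      wirtinger_has_derivative[OF has_derivative_mult[OF fg]]
    by (cases x) (simp_all add: field_simps)
qed

lemma wirtinger_sum:
  assumes "finite I" and "\<And>i. i \<in> I \<Longrightarrow> f i differentiable (at z)"
  shows "wirtinger x (\<lambda>w. \<Sum>i\<in>I. f i w) z = (\<Sum>i\<in>I. wirtinger x (f i) z)"
  using assms
  by (induction I rule: finite_induct)
     (simp_all add: wirtinger_const wirtinger_add differentiable_sum)

lemma wirtinger_cong:
  assumes "open S" and "z \<in> S" and "\<And>w. w \<in> S \<Longrightarrow> f w = g w"
  shows "wirtinger x f z = wirtinger x g z"
proof -
  have "(f has_derivative D) (at z) \<longleftrightarrow> (g has_derivative D) (at z)" for D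
    using has_derivative_transform_within_open[OF _ assms(1,2), of f D UNIV g]
      has_derivative_transform_within_open[OF _ assms(1,2), of g D UNIV f] assms(3) by auto
  then have "frechet_derivative f (at z) = frechet_derivative g (at z)"
    by (simp add: frechet_derivative_def)
  then show ?thesis by (cases x) simp_all
qed

text \<open>
  The function \<open>\<omega> \<circ> chart_inv c\<close> lives on the chart image, so this says that the coefficients of \<open>\<omega>\<close> in
  the chart are real differentiable at \<open>p\<close>, which is what the Leibniz rule for \<open>pd\<close> at \<open>p\<close> uses.
\<close>

definition form_differentiable :: "('m, 'n::finite) chart \<Rightarrow> 'm \<Rightarrow> ('m \<Rightarrow> 'n eform) \<Rightarrow> bool" where
  "form_differentiable c p \<omega> \<longleftrightarrow> (\<forall>a. (\<lambda>z. \<omega> (chart_inv c z) a) differentiable (at (snd c p)))"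

definition pd_form :: "('m, 'n::finite) chart \<Rightarrow> 'n idx \<Rightarrow> ('m \<Rightarrow> 'n eform) \<Rightarrow> 'm \<Rightarrow> 'n eform" where
  "pd_form c x \<omega> p = (\<lambda>a. pd c x (\<lambda>y. \<omega> y a) p)"

lemma pd_form_eq: "pd_form c x \<omega> p a = wirtinger x (\<lambda>z. \<omega> (chart_inv c z) a) (snd c p)"
  by (simp add: pd_form_def pd_def comp_def)

lemma form_differentiable_iota: "form_differentiable c p \<omega> \<Longrightarrow> form_differentiable c p (\<lambda>y. iota x (\<omega> y))"
  by (simp add: form_differentiable_def iota_def)

lemma form_differentiable_wedge:
  "form_differentiable c p \<alpha> \<Longrightarrow> form_differentiable c p \<beta> \<Longrightarrow> form_differentiable c p (\<lambda>y. wedge (\<alpha> y) (\<beta> y))"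
  unfolding form_differentiable_def wedge_def
  by (intro allI differentiable_sum differentiable_mult differentiable_const) auto

lemma sum_form_apply: "(\<Sum>i\<in>I. \<omega> i) a = (\<Sum>i\<in>I. \<omega> i a)" for \<omega> :: "'i \<Rightarrow> 'n eform"
  by (induction I rule: infinite_finite_induct) simp_all

lemma form_differentiable_sum:
  assumes "finite I" and "\<And>i. i \<in> I \<Longrightarrow> form_differentiable c p (\<omega> i)"
  shows "form_differentiable c p (\<lambda>y. \<Sum>i\<in>I. \<omega> i y)"
  using assms unfolding form_differentiable_def sum_form_apply by (auto intro!: differentiable_sum)

lemma form_differentiable_contraction:
  assumes "\<And>i. form_differentiable c p (\<lambda>y. \<phi> y i)" and "form_differentiable c p \<omega>"
  shows "form_differentiable c p (\<lambda>y. contraction (\<phi> y) (\<omega> y))"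
  unfolding contraction_def
  by (intro form_differentiable_sum finite form_differentiable_wedge form_differentiable_iota assms)

lemma pd_form_iota: "pd_form c x (\<lambda>y. iota v (\<omega> y)) p = iota v (pd_form c x \<omega> p)"
  by (simp add: pd_form_def iota_def fun_eq_iff)

lemma pd_form_wedge:
  assumes p: "chart_inv c (snd c p) = p" and "form_differentiable c p \<alpha>" "form_differentiable c p \<beta>"
  shows "pd_form c x (\<lambda>y. wedge (\<alpha> y) (\<beta> y)) p =
    wedge (pd_form c x \<alpha> p) (\<beta> p) + wedge (\<alpha> p) (pd_form c x \<beta> p)"
proof
  fix a
  have d: "(\<lambda>z. \<alpha> (chart_inv c z) l) differentiable (at (snd c p))"
    "(\<lambda>z. \<beta> (chart_inv c z) l) differentiable (at (snd c p))" for l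
    using assms by (auto simp: form_differentiable_def)
  have "wirtinger x (\<lambda>z. k * \<alpha> (chart_inv c z) l * \<beta> (chart_inv c z) l') (snd c p) =
      k * pd_form c x \<alpha> p l * \<beta> p l' + k * \<alpha> p l * pd_form c x \<beta> p l'" for k l l'
    by (simp add: wirtinger_mult wirtinger_const differentiable_mult d pd_form_eq p)
  then show "pd_form c x (\<lambda>y. wedge (\<alpha> y) (\<beta> y)) p a =
      (wedge (pd_form c x \<alpha> p) (\<beta> p) + wedge (\<alpha> p) (pd_form c x \<beta> p)) a"
    unfolding pd_form_eq[of c x "\<lambda>y. wedge (\<alpha> y) (\<beta> y)"] plus_fun_apply wedge_def
    by (subst wirtinger_sum) (auto simp: sum.distrib intro!: differentiable_mult d)
qed

lemma pd_form_sum: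
  assumes "finite I" and "\<And>i. i \<in> I \<Longrightarrow> form_differentiable c p (\<omega> i)"
  shows "pd_form c x (\<lambda>y. \<Sum>i\<in>I. \<omega> i y) p = (\<Sum>i\<in>I. pd_form c x (\<omega> i) p)"
  using assms
  by (intro ext) (simp add: pd_form_eq sum_form_apply wirtinger_sum form_differentiable_def)

lemma pd_form_contraction:
  assumes "chart_inv c (snd c p) = p"
    and "\<And>i. form_differentiable c p (\<lambda>y. \<phi> y i)" and "form_differentiable c p \<omega>"
  shows "pd_form c x (\<lambda>y. contraction (\<phi> y) (\<omega> y)) p =
    contraction (\<lambda>i. pd_form c x (\<lambda>y. \<phi> y i) p) (\<omega> p) + contraction (\<phi> p) (pd_form c x \<omega> p)"
  unfolding contraction_def
  by (simp add: pd_form_sum form_differentiable_wedge form_differentiable_iota pd_form_wedge pd_form_iota assms sum.distrib)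

text \<open>
  With \<open>d\<close> in this form, its commutation with contractions reduces to the derivation property on the
  coframe and to the Leibniz rule for each \<open>\<partial>\<^sub>x\<close>.
\<close>

lemma ext_d_eq_sum_coframe: "ext_d c \<omega> p = (\<Sum>x\<in>UNIV. wedge (coframe x) (pd_form c x \<omega> p))"
proof
  fix a
  have "(\<Sum>x\<in>UNIV. wedge (coframe x) (pd_form c x \<omega> p)) a =
     (\<Sum>j<length a. \<Sum>x\<in>UNIV. if a ! j = x then (- 1) ^ j * pd_form c x \<omega> p (nths a (- {j})) else 0)"
    unfolding sum_form_apply wedge_coframe by (rule sum.swap)
  then show "ext_d c \<omega> p a = (\<Sum>x\<in>UNIV. wedge (coframe x) (pd_form c x \<omega> p)) a"
    by (simp add: ext_d_def pd_form_def)
qed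

section \<open>The iterated commutator\<close>

text \<open>
  Apply \<open>\<phi> \<lrcorner>\<close> to \<open>d\<omega> = \<Sum>\<^sub>x e\<^sup>x \<and> \<partial>\<^sub>x \<omega>\<close>, where \<open>e\<^sup>x\<close> is the coframe. The derivation hits \<open>e\<^sup>x\<close>, which
  gives \<open>\<phi>\<^sup>i\<close> for \<open>x = Inl i\<close> and \<open>0\<close> otherwise, or it hits \<open>\<partial>\<^sub>x \<omega>\<close>; in the second case it differs
  from \<open>\<partial>\<^sub>x (\<phi> \<lrcorner> \<omega>)\<close> by the contraction with \<open>\<partial>\<^sub>x \<phi>\<close>.
\<close>

lemma contraction_ext_d_commutator:
  assumes p: "chart_inv c (snd c p) = p"
    and "\<And>i. form_differentiable c p (\<lambda>y. \<phi> y i)" and "form_differentiable c p \<omega>"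
    and deg: "\<And>i. homogeneous 1 (\<phi> p i)"
  shows "contraction (\<phi> p) (ext_d c \<omega> p) - ext_d c (\<lambda>y. contraction (\<phi> y) (\<omega> y)) p =
    (\<Sum>i\<in>UNIV. wedge (\<phi> p i) (pd_form c (Inl i) \<omega> p))
    - (\<Sum>x\<in>UNIV. wedge (coframe x) (contraction (\<lambda>i. pd_form c x (\<lambda>y. \<phi> y i) p) (\<omega> p)))"
proof -
  have "(\<Sum>x\<in>UNIV. wedge (contraction (\<phi> p) (coframe x)) (pd_form c x \<omega> p)) =
      (\<Sum>i\<in>UNIV. wedge (\<phi> p i) (pd_form c (Inl i) \<omega> p))"
    by (simp add: UNIV_Plus_UNIV[symmetric] sum.Plus contraction_coframe del: UNIV_Plus_UNIV)
  then show ?thesis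
    by (simp add: ext_d_eq_sum_coframe contraction_sum contraction_wedge[OF deg]
        pd_form_contraction assms(1-3) wedge_add_right sum.distrib)
qed

text \<open>
  The case of the trivial line bundle with its flat connection. The right-hand side is
  \<open>[i\<^sub>\<phi>, d] i\<^sub>\<psi> - i\<^sub>\<psi> [i\<^sub>\<phi>, d]\<close> applied to \<open>\<omega>\<close>. In the commutator of \<open>i\<^sub>\<psi>\<close> with
  \<open>[i\<^sub>\<phi>, d] = \<Sum>\<^sub>i \<phi>\<^sup>i \<and> \<partial>\<^sub>i - \<Sum>\<^sub>x e\<^sup>x \<and> i\<^bsub>\<partial>x\<phi>\<^esub>\<close> the terms with derivatives of \<open>\<omega>\<close> cancel, as do those
  with two contractions: only \<open>\<partial>\<^sub>i\<close> hitting \<open>\<psi>\<close> and \<open>i\<^sub>\<psi>\<close> hitting \<open>e\<^sup>x\<close> survive, and they are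
  the two halves of the bracket.
\<close>

lemma tian_todorov_ext_d:
  fixes \<phi> \<psi> :: "'m \<Rightarrow> 'n::finite \<Rightarrow> 'n eform"
  assumes p: "chart_inv c (snd c p) = p"
    and s\<phi>: "\<And>i. form_differentiable c p (\<lambda>y. \<phi> y i)" and s\<psi>: "\<And>i. form_differentiable c p (\<lambda>y. \<psi> y i)"
    and s\<omega>: "form_differentiable c p \<omega>"
    and t\<phi>: "\<And>i. form01 (\<phi> p i)" and t\<psi>: "\<And>i. form01 (\<psi> p i)"
    and td\<phi>: "\<And>x i. form01 (pd_form c x (\<lambda>y. \<phi> y i) p)"
    and skew: "\<And>i j. iota (Inl i) (iota (Inl j) (\<omega> p)) = - iota (Inl j) (iota (Inl i) (\<omega> p))"
  shows "contraction (\<lambda>j. \<Sum>i\<in>UNIV. wedge (\<phi> p i) (pd_form c (Inl i) (\<lambda>y. \<psi> y j) p)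
                                  + wedge (\<psi> p i) (pd_form c (Inl i) (\<lambda>y. \<phi> y j) p)) (\<omega> p)
    = contraction (\<phi> p) (ext_d c (\<lambda>y. contraction (\<psi> y) (\<omega> y)) p)
      - ext_d c (\<lambda>y. contraction (\<phi> y) (contraction (\<psi> y) (\<omega> y))) p
      + contraction (\<psi> p) (ext_d c (\<lambda>y. contraction (\<phi> y) (\<omega> y)) p)
      - contraction (\<psi> p) (contraction (\<phi> p) (ext_d c \<omega> p))"
    (is "?lhs = ?a - ?b + ?c - ?d")
proof -
  define d\<phi> where "d\<phi> x = (\<lambda>i. pd_form c x (\<lambda>y. \<phi> y i) p)" for x
  define d\<psi> where "d\<psi> x = (\<lambda>i. pd_form c x (\<lambda>y. \<psi> y i) p)" for x
  define d\<omega> where "d\<omega> x = pd_form c x \<omega> p" for x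
  note deg = form01_degree[OF t\<phi>] form01_degree[OF t\<psi>]
  have *: "?a - ?b =
      (\<Sum>i\<in>UNIV. wedge (\<phi> p i) (contraction (d\<psi> (Inl i)) (\<omega> p)))
    + (\<Sum>i\<in>UNIV. wedge (\<phi> p i) (contraction (\<psi> p) (d\<omega> (Inl i))))
    - (\<Sum>x\<in>UNIV. wedge (coframe x) (contraction (\<psi> p) (contraction (d\<phi> x) (\<omega> p))))"
  proof -
    \<comment> \<open>The derivative \<open>\<partial>\<^sub>x \<phi>\<close> has type \<open>(0,1)\<close> as well, so it commutes with \<open>\<psi>\<close>.\<close>
    have "contraction (d\<phi> x) (contraction (\<psi> p) (\<omega> p)) = contraction (\<psi> p) (contraction (d\<phi> x) (\<omega> p))" for x
      unfolding d\<phi>_def by (intro contraction_commute td\<phi> t\<psi> skew)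
    then show ?thesis
      using contraction_ext_d_commutator[where \<phi> = \<phi>, OF p s\<phi> form_differentiable_contraction[where \<phi> = \<psi>, OF s\<psi> s\<omega>] deg(1)]
      by (simp add: pd_form_contraction p s\<psi> s\<omega> wedge_add_right sum.distrib
          flip: d\<phi>_def d\<psi>_def d\<omega>_def)
  qed
  have c: "(\<Sum>x\<in>UNIV. wedge (contraction (\<psi> p) (coframe x)) (f x)) = (\<Sum>i\<in>UNIV. wedge (\<psi> p i) (f (Inl i)))"
    for f
    by (simp add: UNIV_Plus_UNIV[symmetric] sum.Plus contraction_coframe del: UNIV_Plus_UNIV)
  have "?d - ?c = contraction (\<psi> p)
     ((\<Sum>i\<in>UNIV. wedge (\<phi> p i) (d\<omega> (Inl i)))
      - (\<Sum>x\<in>UNIV. wedge (coframe x) (contraction (d\<phi> x) (\<omega> p))))"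
    using contraction_ext_d_commutator[where \<phi> = \<phi>, OF p s\<phi> s\<omega> deg(1)]
    by (simp add: d\<omega>_def d\<phi>_def flip: contraction_diff)
  also have "\<dots> = (\<Sum>i\<in>UNIV. wedge (\<phi> p i) (contraction (\<psi> p) (d\<omega> (Inl i))))
    - (\<Sum>i\<in>UNIV. wedge (\<psi> p i) (contraction (d\<phi> (Inl i)) (\<omega> p)))
    - (\<Sum>x\<in>UNIV. wedge (coframe x) (contraction (\<psi> p) (contraction (d\<phi> x) (\<omega> p))))"
    by (simp add: contraction_diff contraction_sum contraction_wedge[OF deg(2)]
        contraction_form01[OF t\<phi>] sum.distrib c)
  finally have **: "?d - ?c = \<dots>" .
  have "?lhs = (\<Sum>i\<in>UNIV. wedge (\<phi> p i) (contraction (d\<psi> (Inl i)) (\<omega> p)))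
    + (\<Sum>i\<in>UNIV. wedge (\<psi> p i) (contraction (d\<phi> (Inl i)) (\<omega> p)))"
    unfolding contraction_def d\<phi>_def d\<psi>_def
    unfolding wedge_sum_left wedge_sum_right wedge_add_left sum.distrib wedge_assoc
    by (intro arg_cong2[where f = "(+)"]; rule sum.swap)
  also have "\<dots> = ?a - ?b - (?d - ?c)"
    unfolding * ** by simp
  finally show ?thesis by simp
qed

text \<open>
  The same iterated commutator for multiplication by a connection form \<open>\<theta>\<close> in place of \<open>d\<close>. By the
  derivation property, commuting twice with multiplication by \<open>\<theta>\<close> leaves multiplication by the two-fold
  contraction of \<open>\<theta>\<close>, which is zero.
\<close>

lemma tian_todorov_wedge_one_form:
  assumes t\<phi>: "\<And>i. form01 (\<phi> i)" and t\<psi>: "\<And>i. form01 (\<psi> i)"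
    and deg: "homogeneous 1 \<theta>"
    and skew: "\<And>i j. iota (Inl i) (iota (Inl j) \<omega>) = - iota (Inl j) (iota (Inl i) \<omega>)"
  shows "contraction \<phi> (wedge (contraction \<psi> \<omega>) \<theta>) - wedge (contraction \<psi> (contraction \<phi> \<omega>)) \<theta>
     + contraction \<psi> (wedge (contraction \<phi> \<omega>) \<theta>)
     - contraction \<psi> (contraction \<phi> (wedge \<omega> \<theta>)) = 0"
  using contraction_commute[where \<phi> = \<phi> and \<psi> = \<psi>, OF t\<phi> t\<psi> skew]
  by (simp add: contraction_wedge[OF form01_degree[OF t\<phi>]]
      contraction_wedge[OF form01_degree[OF t\<psi>]] contraction_add
      contraction_twice_degree1[OF t\<phi> deg])

section \<open>Charts and frames\<close>

lemma chart_inv_chart: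
  assumes "complex_manifold A" and "c \<in> A" and "p \<in> fst c"
  shows "chart_inv c (snd c p) = p"
  using assms unfolding complex_manifold_def homeomorphism_def by blast

lemma open_chart_image:
  assumes "complex_manifold A" and "c \<in> A" and "open U" and "U \<subseteq> fst c"
  shows "open (snd c ` U)"
proof -
  have hom: "homeomorphism (fst c) (snd c ` fst c) (snd c) (chart_inv c)"
    and op: "open (snd c ` fst c)"
    using assms(1,2) unfolding complex_manifold_def by blast+
  have "openin (top_of_set (fst c)) U"
    using assms(3,4) by (simp add: open_subset)
  then have "openin (top_of_set (snd c ` fst c)) (snd c ` U)"
    using homeomorphism_imp_open_map[OF hom] by blast
  then show ?thesis using op openin_open_trans by blast
qed

lemma open_chart_domain: "complex_manifold A \<Longrightarrow> c \<in> A \<Longrightarrow> open (fst c)"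
  by (simp add: complex_manifold_def)

lemma pd_cong:
  assumes A: "complex_manifold A" "c \<in> A" and U: "open U" "U \<subseteq> fst c" "p \<in> U"
    and eq: "\<And>x. x \<in> U \<Longrightarrow> f x = g x"
  shows "pd c x f p = pd c x g p"
proof -
  have "(f \<circ> chart_inv c) w = (g \<circ> chart_inv c) w" if "w \<in> snd c ` U" for w
    using that U(2) eq chart_inv_chart[OF A] by auto
  then show ?thesis
    unfolding pd_def by (intro wirtinger_cong[OF open_chart_image[OF A U(1,2)]]) (use U(3) in auto)
qed

lemma ext_d_cong:
  assumes "complex_manifold A" "c \<in> A" and "open U" "U \<subseteq> fst c" "p \<in> U"
    and "\<And>x. x \<in> U \<Longrightarrow> \<omega> x = \<omega>' x"
  shows "ext_d c \<omega> p = ext_d c \<omega>' p"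
  unfolding ext_d_def
  by (intro ext sum.cong refl arg_cong2[where f = "(*)"] pd_cong[OF assms(1-5)]) (simp add: assms(6))

lemma smooth_on_differentiable: "smooth_on S f \<Longrightarrow> z \<in> S \<Longrightarrow> f differentiable (at z)"
  by (metis Ck_on.simps(2) smooth_on_def)

lemma smooth_in_imp_form_differentiable:
  assumes "\<And>a. smooth_in c S (\<lambda>x. \<omega> x a)" and "p \<in> S" "p \<in> fst c"
  shows "form_differentiable c p \<omega>"
  unfolding form_differentiable_def
proof
  fix a
  have "smooth_on (snd c ` (S \<inter> fst c)) ((\<lambda>x. \<omega> x a) \<circ> chart_inv c)"
    using assms(1) by (simp add: smooth_in_def)
  then have "((\<lambda>x. \<omega> x a) \<circ> chart_inv c) differentiable (at (snd c p))"
    by (rule smooth_on_differentiable) (use assms(2,3) in auto)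
  then show "(\<lambda>z. \<omega> (chart_inv c z) a) differentiable (at (snd c p))"
    by (simp add: comp_def)
qed

lemma is_kform_degree: "is_kform k \<omega> \<Longrightarrow> homogeneous k \<omega>"
  by (simp add: is_kform_def homogeneous_def)

lemma is_kform_skew: 
  assumes "is_kform k \<omega>"
  shows "iota x (iota y \<omega>) = - iota y (iota x \<omega>)"
proof
  fix a
  have "\<omega> ((y # x # a)[0 := (y # x # a) ! 1, 1 := (y # x # a) ! 0]) = - \<omega> (y # x # a)"
    using assms unfolding is_kform_def by (metis length_Cons less_Suc_eq_0_disj zero_less_one One_nat_def Suc_less_eq)
  then show "iota x (iota y \<omega>) a = (- iota y (iota x \<omega>)) a"
    by (simp add: iota_def)
qed

lemma is_pqform_form01:
  fixes \<alpha> :: "'n eform"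
  assumes "is_pqform 0 1 \<alpha>" shows "form01 \<alpha>"
  unfolding form01_def
proof (intro allI impI)
  fix a :: "'n idx list" assume a: "\<nexists>j. a = [Inr j]"
  show "\<alpha> a = 0"
  proof (cases "length a = 1")
    case True
    then obtain i where "a = [Inl i]"
      using a by (metis One_nat_def length_0_conv length_Suc_conv old.sum.exhaust)
    then show ?thesis using assms by (simp add: is_pqform_def)
  next
    case False
    then show ?thesis using assms by (simp add: is_pqform_def is_kform_def)
  qed
qed

lemma form01_pd_form:
  fixes \<alpha> :: "'m::{t2_space, second_countable_topology} \<Rightarrow> 'n::finite eform"
  assumes A: "complex_manifold A" "c \<in> A" and "p \<in> fst c"
    and "\<And>x. x \<in> fst c \<Longrightarrow> form01 (\<alpha> x)"
  shows "form01 (pd_form c x \<alpha> p)"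
  unfolding form01_def
proof (intro allI impI)
  fix a :: "'n idx list" assume a: "\<nexists>j. a = [Inr j]"
  have "pd c x (\<lambda>y. \<alpha> y a) p = pd c x (\<lambda>y. 0) p"
    using assms(4) a
    by (intro pd_cong[OF A open_chart_domain[OF A] _ assms(3)]) (auto simp: form01_def)
  then show "pd_form c x \<alpha> p a = 0"
    by (simp add: pd_form_def pd_def comp_def wirtinger_const)
qed

lemma
  assumes "holomorphic_vector_bundle A \<pi> T" and "t \<in> T" and "p \<in> fst t"
  shows fib_vec_proj: "\<pi> (fib_vec \<pi> t p u) = p"
    and fib_vec_component: "snd t (fib_vec \<pi> t p u) = u"
proof -
  obtain g where "homeomorphism (\<pi> -` fst t) (fst t \<times> UNIV) (\<lambda>e. (\<pi> e, snd t e)) g"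
    using assms(1,2) unfolding holomorphic_vector_bundle_def by blast
  then have im: "(\<lambda>e. (\<pi> e, snd t e)) ` (\<pi> -` fst t) = fst t \<times> UNIV"
    and inj: "\<And>e. \<pi> e \<in> fst t \<Longrightarrow> g (\<pi> e, snd t e) = e"
    by (auto simp: homeomorphism_def)
  have "(p, u) \<in> (\<lambda>e. (\<pi> e, snd t e)) ` (\<pi> -` fst t)"
    unfolding im using assms(3) by simp
  then obtain e where "\<pi> e = p" "snd t e = u" by auto
  then have "\<exists>!e. \<pi> e = p \<and> snd t e = u"
    using inj assms(3) by metis
  then have "\<pi> (fib_vec \<pi> t p u) = p \<and> snd t (fib_vec \<pi> t p u) = u"
    unfolding fib_vec_def by (rule theI')
  then show "\<pi> (fib_vec \<pi> t p u) = p" "snd t (fib_vec \<pi> t p u) = u" by auto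
qed

text \<open>
  The components of a holomorphic frame in another trivialization are a column of the transition matrix.
\<close>

lemma smooth_section_frame:
  assumes "holomorphic_vector_bundle A \<pi> T" and "t \<in> T"
  shows "smooth_section A \<pi> T (fst t) (frame \<pi> t j)"
  unfolding smooth_section_def
proof (intro conjI ballI allI)
  fix p assume "p \<in> fst t"
  then show "\<pi> (frame \<pi> t j p) = p"
    unfolding frame_def by (rule fib_vec_proj[OF assms])
next
  fix c t' i assume "c \<in> A" "t' \<in> T"
  then have "holo_in c (fst t' \<inter> fst t) (\<lambda>p. trans_mat \<pi> t' t p $ i $ j)"
    using assms unfolding holomorphic_vector_bundle_def by blast
  then show "smooth_in c (fst t \<inter> fst t') (\<lambda>p. snd t' (frame \<pi> t j p) $ i)"
    by (simp add: holo_in_def smooth_in_def holo_on_def trans_mat_def Int_commute)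
qed

text \<open>
  Applied to a frame section, this says that the connection forms are 1-forms.
\<close>

lemma connection_form_degree:
  assumes "connection A \<pi> T D" and "open S" and "smooth_section A \<pi> T S s"
    and "c \<in> A" "t \<in> T" "p \<in> S" "p \<in> fst c" "p \<in> fst t"
  shows "homogeneous 1 (D S s c t p b)"
proof -
  have "\<forall>S s. open S \<and> smooth_section A \<pi> T S s \<longrightarrow> smooth_kform A \<pi> T S 1 (D S s)"
    using assms(1) unfolding connection_def by (rule conjunct1)
  then have "smooth_kform A \<pi> T S 1 (D S s)"
    using assms(2,3) by simp
  then have "is_kform 1 (D S s c t p b)"
    using assms(4-8) by (simp add: smooth_kform_def)
  then show ?thesis by (rule is_kform_degree)
qed

section \<open>The commutator formula for bundle-valued forms\<close>

lemma interior_partial_eq_iota: "interior_partial i \<omega> = iota (Inl i) \<omega>"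
  by (simp add: interior_partial_def iota_def fun_eq_iff)

lemma contract_eq_contraction: "(\<phi> \<lrcorner> \<eta>) c t p b = contraction (\<phi> c p) (\<eta> c t p b)"
  by (simp add: contract_def contraction_def interior_partial_eq_iota)

lemma bracket_eq_pd_form:
  "bracket \<phi> \<psi> c p j =
     (\<Sum>i\<in>UNIV. wedge (\<phi> c p i) (pd_form c (Inl i) (\<lambda>x. \<psi> c x j) p)
             + wedge (\<psi> c p i) (pd_form c (Inl i) (\<lambda>x. \<phi> c x j) p))"
  by (simp add: bracket_def pd_form_def)

text \<open>
  The sign \<open>(-1)\<^sup>k\<close> is absorbed into the connection form, which leaves a plain sum of wedge products
  to which the derivation property applies.
\<close>

lemma nabla_eq:
  "nabla \<pi> D k \<eta> c t p b = ext_d c (\<lambda>x. \<eta> c t x b) p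
     + (\<Sum>b'\<in>UNIV. wedge (\<eta> c t p b') (\<lambda>a. (- 1) ^ k * D (fst t) (frame \<pi> t b') c t p b a))"
  by (rule ext) (simp add: nabla_def sum_form_apply wedge_scale_right sum_distrib_left)

theorem theorem3p4:
  fixes A :: "('m::{t2_space, second_countable_topology}, 'n::finite) chart set"
    and \<pi> :: "'e::topological_space \<Rightarrow> 'm"
    and T :: "('m, 'e, 'r::finite) triv set"
    and h :: "'e \<Rightarrow> 'e \<Rightarrow> complex"
    and D :: "'m set \<Rightarrow> ('m \<Rightarrow> 'e) \<Rightarrow> ('m, 'n, 'e, 'r) vform"
    and \<eta> :: "('m, 'n, 'e, 'r) vform"
    and \<phi>1 \<phi>2 :: "('m, 'n) tform"
    and q :: nat
  assumes "complex_manifold A"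
    and "holomorphic_vector_bundle A \<pi> T"
    and "hermitian_metric A \<pi> T h"
    and "chern_connection A \<pi> T h D"
    and "smooth_pqform A \<pi> T CARD('n) q \<eta>"
    and "smooth_0q_T10 A 1 \<phi>1"
    and "smooth_0q_T10 A 1 \<phi>2"
  shows "vform_eq A T UNIV
    (bracket \<phi>1 \<phi>2 \<lrcorner> \<eta>)
    (\<phi>1 \<lrcorner> nabla \<pi> D (CARD('n) + q) (\<phi>2 \<lrcorner> \<eta>) 
     - nabla \<pi> D (CARD('n) + q) (\<phi>2 \<lrcorner> (\<phi>1 \<lrcorner> \<eta>))
     + \<phi>2 \<lrcorner> nabla \<pi> D (CARD('n) + q) (\<phi>1 \<lrcorner> \<eta>)
     - \<phi>2 \<lrcorner> (\<phi>1 \<lrcorner> nabla \<pi> D (CARD('n) + q) \<eta>))"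
  unfolding vform_eq_def
proof (intro ballI, rule ext)
  fix c t p b
  assume cA: "c \<in> A" and tT: "t \<in> T" and "p \<in> UNIV \<inter> fst c \<inter> fst t"
  then have pc: "p \<in> fst c" and pt: "p \<in> fst t" by auto
  define U where "U = fst c \<inter> fst t"
  have U: "open U" "U \<subseteq> fst c" "p \<in> U"
    using assms(2) open_chart_domain[OF assms(1) cA] tT pc pt
    by (auto simp: U_def holomorphic_vector_bundle_def)
  have p: "chart_inv c (snd c p) = p"
    by (rule chart_inv_chart[OF assms(1) cA pc])
  have \<phi>_01: "form01 (\<phi>1 c x i)" "form01 (\<phi>2 c x i)" if "x \<in> fst c" for x i
    using assms(6,7) cA that by (auto simp: smooth_0q_T10_def intro: is_pqform_form01)
  have \<phi>_smooth: "form_differentiable c p (\<lambda>x. \<phi>1 c x i)" "form_differentiable c p (\<lambda>x. \<phi>2 c x i)" for i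
    using assms(6,7) cA pc
    by (auto simp: smooth_0q_T10_def intro!: smooth_in_imp_form_differentiable[where S = UNIV])
  have d\<phi>_01: "form01 (pd_form c x (\<lambda>y. \<phi>1 c y i) p)" for x i
    by (rule form01_pd_form[OF assms(1) cA pc]) (rule \<phi>_01)
  have \<eta>_smooth: "form_differentiable c p (\<lambda>x. \<eta> c t x b)"
    by (rule smooth_in_imp_form_differentiable[where S = "UNIV \<inter> fst t"])
       (use assms(5) cA tT pc pt in \<open>auto simp: smooth_pqform_def smooth_kform_def\<close>)
  have \<eta>_skew: "iota (Inl i) (iota (Inl j) (\<eta> c t x b')) = - iota (Inl j) (iota (Inl i) (\<eta> c t x b'))"
    if "x \<in> U" for x b' i j
    by (rule is_kform_skew[of "CARD('n) + q"])
       (use assms(5) cA tT that in \<open>simp add: smooth_pqform_def smooth_kform_def U_def\<close>)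
  \<comment> \<open>The connection form of the frame of \<open>t\<close>, up to the sign from the Leibniz rule.\<close>
  define \<theta> where "\<theta> b' = (\<lambda>a. (- 1) ^ (CARD('n) + q) * D (fst t) (frame \<pi> t b') c t p b a)" for b'
  have \<theta>: "homogeneous 1 (\<theta> b')" for b'
  proof -
    have "connection A \<pi> T D" "open (fst t)"
      using assms(2,4) tT by (simp_all add: chern_connection_def holomorphic_vector_bundle_def)
    from connection_form_degree[OF this smooth_section_frame[OF assms(2) tT] cA tT pt pc pt]
    show ?thesis by (simp add: \<theta>_def homogeneous_def)
  qed
  define i1 where "i1 x = contraction (\<phi>1 c x)" for x
  define i2 where "i2 x = contraction (\<phi>2 c x)" for x
  let ?\<eta> = "\<lambda>x. \<eta> c t x b"

  \<comment> \<open>The contractions must be exchanged on a whole neighbourhood of \<open>p\<close>, as \<open>d\<close> is applied afterwards.\<close>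
  have swap: "ext_d c (\<lambda>x. i2 x (i1 x (?\<eta> x))) p = ext_d c (\<lambda>x. i1 x (i2 x (?\<eta> x))) p"
  proof (rule ext_d_cong[OF assms(1) cA U])
    fix x assume x: "x \<in> U"
    with U(2) have "x \<in> fst c" by auto
    then show "i2 x (i1 x (?\<eta> x)) = i1 x (i2 x (?\<eta> x))"
      unfolding i1_def i2_def using x by (intro contraction_commute \<phi>_01 \<eta>_skew)
  qed
  have der: "contraction (bracket \<phi>1 \<phi>2 c p) (?\<eta> p)
      = i1 p (ext_d c (\<lambda>x. i2 x (?\<eta> x)) p) - ext_d c (\<lambda>x. i2 x (i1 x (?\<eta> x))) p
        + i2 p (ext_d c (\<lambda>x. i1 x (?\<eta> x)) p) - i2 p (i1 p (ext_d c ?\<eta> p))"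
    unfolding swap
    unfolding bracket_eq_pd_form i1_def i2_def
    by (intro tian_todorov_ext_d[where \<phi> = "\<phi>1 c" and \<psi> = "\<phi>2 c" and \<omega> = ?\<eta>]
        p \<phi>_smooth \<eta>_smooth \<phi>_01 pc d\<phi>_01 \<eta>_skew U(3))

  have "i1 p (wedge (i2 p (\<eta> c t p b')) (\<theta> b')) - wedge (i2 p (i1 p (\<eta> c t p b'))) (\<theta> b')
      + i2 p (wedge (i1 p (\<eta> c t p b')) (\<theta> b')) - i2 p (i1 p (wedge (\<eta> c t p b') (\<theta> b'))) = 0" for b'
    unfolding i1_def i2_def
    by (intro tian_todorov_wedge_one_form \<phi>_01 pc \<theta> \<eta>_skew U(3))
  then have alg: "(\<Sum>b'\<in>UNIV. i1 p (wedge (i2 p (\<eta> c t p b')) (\<theta> b')))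
      - (\<Sum>b'\<in>UNIV. wedge (i2 p (i1 p (\<eta> c t p b'))) (\<theta> b'))
      + (\<Sum>b'\<in>UNIV. i2 p (wedge (i1 p (\<eta> c t p b')) (\<theta> b')))
      - (\<Sum>b'\<in>UNIV. i2 p (i1 p (wedge (\<eta> c t p b') (\<theta> b')))) = 0"
    by (simp only: sum.distrib[symmetric] sum_subtractf[symmetric] sum.neutral_const)

  have at_b: "(X - Y + Z - W) c t p b = X c t p b - Y c t p b + Z c t p b - W c t p b"
    for X Y Z W :: "('m, 'n, 'e, 'r) vform"
    by simp
  have regroup: "(x + x') - (y + y') + (z + z') - (w + w') = (x - y + z - w) + (x' - y' + z' - w')"
    for x x' y y' z z' w w' :: "'n eform"
    by (simp add: algebra_simps)
  show "(bracket \<phi>1 \<phi>2 \<lrcorner> \<eta>) c t p b =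
    (\<phi>1 \<lrcorner> nabla \<pi> D (CARD('n) + q) (\<phi>2 \<lrcorner> \<eta>)
     - nabla \<pi> D (CARD('n) + q) (\<phi>2 \<lrcorner> (\<phi>1 \<lrcorner> \<eta>))
     + \<phi>2 \<lrcorner> nabla \<pi> D (CARD('n) + q) (\<phi>1 \<lrcorner> \<eta>)
     - \<phi>2 \<lrcorner> (\<phi>1 \<lrcorner> nabla \<pi> D (CARD('n) + q) \<eta>)) c t p b"
    unfolding at_b contract_eq_contraction nabla_eq \<theta>_def[symmetric]
    unfolding contraction_add contraction_sum regroup
    unfolding i1_def[symmetric] i2_def[symmetric] der alg
    by (rule add_0_right[symmetric])
qed

end
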